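(* Let $N\geq 2$ be an integer. Then there exists a set $A\subseteq \mathbb{N}$ such that $R_2(A,n)=R_2(\mathbb{N}\setminus A,n)$ for all integers $n\geq 2N-1$, $|A\cap A_0|=+\infty$, $|A\cap B_0|=+\infty$, and $$R_2(A,n)\leq \frac{n+1}{4\cdot 2^{\lfloor \log _2(N-1) \rfloor }}$$ for infinitely many integers $n$.
   Context: $\mathbb{N}$ denotes the set of nonnegative integers (including $0$). For $A\subseteq\mathbb{N}$ and an integer $n$, $R_2(A,n)$ denotes the number of solutions of $n=a+a'$ with $a,a'\in A$ and $a<a'$. For $a\in\mathbb{N}$, $D(a)$ is the number of ones in the binary representation of $a$ (with $D(0)=0$). $A_0$ is the set of all $a\in\mathbb{N}$ with $D(a)$ even (the Thue–Morse set), and $B_0=\mathbb{N}\setminus A_0$. *)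

theory Defs
  imports Complex_Main
begin

definition R2 :: "nat set \<Rightarrow> int \<Rightarrow> nat" where
  "R2 A n = card {(a, a'). a \<in> A \<and> a' \<in> A \<and> a < a' \<and> n = int a + int a'}"

definition binary_ones :: "nat \<Rightarrow> nat" where
  "binary_ones a = card {k. bit a k}"

definition A0 :: "nat set" where
  "A0 = {a. even (binary_ones a)}"

definition B0 :: "nat set" where
  "B0 = - A0"

end

theory Submission
  imports Defs
begin

text \<open>
  Put $\varepsilon_a = 1$ for $a \in A$ and $\varepsilon_a = -1$ otherwise. Pairing $a$ with $n - a$
  shows that $2(R_2(A,n) - R_2(\mathbb{N} \setminus A,n))$ is $\sum_{a \le n} \varepsilon_a$, minus
  $\varepsilon_{n/2}$ if $n$ is even. With $k = \lfloor\log_2(N-1)\rfloor$, let $F$ consist of $0$ and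
  all numbers whose binary expansion begins with $1$ followed by $k+1$ zeros, and take for $A$ the
  symmetric difference of $A_0$ and $F$. Then $\varepsilon_{2j} = \varepsilon_j = -\varepsilon_{2j+1}$
  except for $j = 0$ and $j = 2^k$, and these two exceptions cancel, so the sums vanish as required.
  If $L$ is odd and $a + a' = 2^L - 1$, then exactly one of $a, a'$ lies in $A_0$. If both lie in
  $A$, the other one belongs to $F \setminus A_0$, which has at most $2^{L-k-2}$ elements
  below $2^L$.
\<close>

section \<open>Binary digit sums and the Thue-Morse set\<close>

lemma finite_bits_nat: "finite {k. bit (a::nat) k}"
proof (rule finite_subset)
  show "{k. bit a k} \<subseteq> {..<a}"
  proof
    fix k assume "k \<in> {k. bit a k}"
    then have "a div 2 ^ k \<noteq> 0" by (auto simp: bit_iff_odd intro: ccontr)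
    then have "2 ^ k \<le> a" by (meson div_less not_le)
    moreover have "k < 2 ^ k" by (rule less_exp)
    ultimately show "k \<in> {..<a}" by (simp add: less_le_trans del: less_exp)
  qed
qed simp

lemma binary_ones_double: "binary_ones (2 * a) = binary_ones a"
proof -
  have "bit (2 * a) k \<longleftrightarrow> (\<exists>j. k = Suc j \<and> bit a j)" for k
    by (cases k) (auto simp: bit_0 bit_Suc)
  then have "{k. bit (2 * a) k} = Suc ` {k. bit a k}"
    by auto
  then show ?thesis by (simp add: binary_ones_def card_image)
qed

lemma binary_ones_Suc_double: "binary_ones (Suc (2 * a)) = Suc (binary_ones a)"
proof -
  have "bit (Suc (2 * a)) k \<longleftrightarrow> k = 0 \<or> (\<exists>j. k = Suc j \<and> bit a j)" for k
    by (cases k) (auto simp: bit_0 bit_Suc)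
  then have "{k. bit (Suc (2 * a)) k} = insert 0 (Suc ` {k. bit a k})"
    by auto
  then show ?thesis by (simp add: binary_ones_def card_image finite_bits_nat)
qed

lemma double_in_A0_iff: "2 * a \<in> A0 \<longleftrightarrow> a \<in> A0"
  by (simp add: A0_def binary_ones_double)

lemma Suc_double_in_A0_iff: "Suc (2 * a) \<in> A0 \<longleftrightarrow> a \<notin> A0"
  by (simp add: A0_def binary_ones_Suc_double)

lemma zero_in_A0: "0 \<in> A0"
proof -
  have "{k. bit (0::nat) k} = {}" by simp
  then show ?thesis by (simp only: A0_def binary_ones_def mem_Collect_eq card.empty even_zero)
qed

lemma one_notin_A0: "Suc 0 \<notin> A0"
  using Suc_double_in_A0_iff[of 0] zero_in_A0 by simp

lemma power_2_notin_A0: "2 ^ j \<notin> A0"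
  by (induction j) (simp_all add: double_in_A0_iff one_notin_A0)

lemma three_times_power_2_in_A0: "3 * 2 ^ j \<in> A0"
proof (induction j)
  case 0
  show ?case using Suc_double_in_A0_iff[of 1] one_notin_A0 by (simp add: numeral_3_eq_3)
next
  case (Suc j)
  then show ?case using double_in_A0_iff[of "3 * 2 ^ j"] by (simp add: mult.left_commute)
qed

text \<open>Membership in \<open>A0\<close> separates the two sides: one number has two binary ones,
  the other a single one.\<close>

lemma three_times_power_2_neq_power_2: "3 * 2 ^ j \<noteq> (2::nat) ^ i"
proof
  assume eq: "3 * 2 ^ j = (2::nat) ^ i"
  show False using three_times_power_2_in_A0[of j] power_2_notin_A0[of i] unfolding eq by contradiction
qed

text \<open>Subtracting from \<open>2 ^ L - 1\<close> inverts all \<open>L\<close> binary digits, so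
  \<open>a\<close> and its complement have \<open>L\<close> ones in total. The induction splits off
  the last digit.\<close>

lemma complement_in_A0_iff:
  "a < 2 ^ L \<Longrightarrow> 2 ^ L - 1 - a \<in> A0 \<longleftrightarrow> (if even L then a \<in> A0 else a \<notin> A0)"
proof (induction L arbitrary: a)
  case 0
  then show ?case by (simp add: zero_in_A0)
next
  case (Suc L)
  define h where "h = a div 2"
  have h: "h < 2 ^ L" using Suc.prems by (auto simp: h_def)
  note IH = Suc.IH[OF h]
  show ?case
  proof (cases "even a")
    case True
    then have a: "a = 2 * h" by (simp add: h_def)
    with h have "2 ^ Suc L - 1 - a = Suc (2 * (2 ^ L - 1 - h))" by simp
    then show ?thesis using IH by (simp only: a Suc_double_in_A0_iff double_in_A0_iff) auto
  next
    case False
    then have a: "a = Suc (2 * h)" by (simp add: h_def)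
    with h have "2 ^ Suc L - 1 - a = 2 * (2 ^ L - 1 - h)" by simp
    then show ?thesis using IH by (simp only: a Suc_double_in_A0_iff double_in_A0_iff) auto
  qed
qed

text \<open>Exactly one of \<open>2 * h\<close> and \<open>Suc (2 * h)\<close> lies in
  \<open>B0\<close>. Halving therefore counts elements of \<open>B0\<close> without
  collisions.\<close>

lemma inj_on_div_2_B0: "inj_on (\<lambda>a. a div 2) B0"
proof (rule inj_onI)
  fix a b assume *: "a \<in> B0" "b \<in> B0" "a div 2 = b div 2"
  define h where "h = a div 2"
  have "c = 2 * (c div 2) \<or> c = Suc (2 * (c div 2))" for c :: nat by presburger
  then have "a = 2 * h \<or> a = Suc (2 * h)" "b = 2 * h \<or> b = Suc (2 * h)"
    using *(3) unfolding h_def by metis+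
  with * show "a = b"
    by (auto simp: B0_def double_in_A0_iff Suc_double_in_A0_iff)
qed

section \<open>Representation counts and partial sums of signs\<close>

definition membership_sign :: "nat set \<Rightarrow> nat \<Rightarrow> int" where
  "membership_sign A a = (if a \<in> A then 1 else -1)"

text \<open>A solution is determined by its smaller term; \<open>2 * a < n\<close> encodes
  \<open>a < a'\<close> and ensures that \<open>n - a\<close> is not truncated.\<close>

lemma R2_eq_card: "R2 A (int n) = card {a. 2 * a < n \<and> a \<in> A \<and> n - a \<in> A}"
proof -
  have "bij_betw (\<lambda>a. (a, n - a)) {a. 2 * a < n \<and> a \<in> A \<and> n - a \<in> A}
      {(a, a'). a \<in> A \<and> a' \<in> A \<and> a < a' \<and> int n = int a + int a'}"
    by (rule bij_betw_byWitness[where f' = fst]) (auto simp flip: of_nat_add)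
  then show ?thesis by (simp add: R2_def bij_betw_same_card)
qed

lemma R2_diff_complement:
  "2 * (int (R2 A (int n)) - int (R2 (- A) (int n))) =
     (\<Sum>a\<le>n. membership_sign A a) - (if even n then membership_sign A (n div 2) else 0)"
proof -
  let ?s = "membership_sign A" and ?L = "{a. 2 * a < n}" and ?U = "{a. a \<le> n \<and> n < 2 * a}"
  have fin: "finite ?L" "finite ?U"
    by (auto intro: finite_subset[of _ "{..n}"])
  have R2_sum: "int (R2 X (int n)) = (\<Sum>a\<in>?L. of_bool (a \<in> X \<and> n - a \<in> X))" for X
  proof -
    have "{a. 2 * a < n \<and> a \<in> X \<and> n - a \<in> X} = ?L \<inter> {a. a \<in> X \<and> n - a \<in> X}" by auto
    then show ?thesis using fin by (simp add: R2_eq_card)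
  qed
  \<comment> \<open>For each pair, twice the indicator of both terms in \<open>A\<close> minus twice
    that of both outside is the sum of the two signs; a mixed pair contributes zero.\<close>
  have "2 * (int (R2 A (int n)) - int (R2 (- A) (int n))) = (\<Sum>a\<in>?L. ?s a + ?s (n - a))"
    unfolding R2_sum sum_subtractf[symmetric] sum_distrib_left
    by (intro sum.cong) (auto simp: membership_sign_def)
  also have "\<dots> = sum ?s ?L + (\<Sum>a\<in>?L. ?s (n - a))" by (rule sum.distrib)
  also have "(\<Sum>a\<in>?L. ?s (n - a)) = sum ?s ?U"
    by (rule sum.reindex_bij_witness[of _ "\<lambda>a. n - a" "\<lambda>a. n - a"]) auto
  also have "sum ?s ?L + sum ?s ?U = sum ?s (?L \<union> ?U)"
    using fin by (intro sum.union_disjoint[symmetric]) auto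
  also have "\<dots> = (\<Sum>a\<le>n. ?s a) - (if even n then ?s (n div 2) else 0)"
  proof (cases "even n")
    case True
    then have "{..n} = insert (n div 2) (?L \<union> ?U)" "n div 2 \<notin> ?L \<union> ?U" by auto
    then show ?thesis using fin True by simp
  next
    case False
    then have "a \<in> {..n} \<longleftrightarrow> a \<in> ?L \<union> ?U" for a
      by (cases "2 * a = n") auto
    then have "{..n} = ?L \<union> ?U" by blast
    then show ?thesis using False by simp
  qed
  finally show ?thesis .
qed

lemma sum_lessThan_double:
  fixes f :: "nat \<Rightarrow> 'a::comm_monoid_add"
  shows "(\<Sum>a<2 * m. f a) = (\<Sum>j<m. f (2 * j) + f (Suc (2 * j)))"
  by (induction m) (simp_all add: add.assoc)

section \<open>Numbers with a prescribed binary prefix\<close>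

text \<open>Division by \<open>2 ^ i\<close> deletes the last \<open>i\<close> digits, so this is
  the set \<open>F\<close> without \<open>0\<close>: expansions beginning with 1 followed by
  \<open>Suc k\<close> zeros.\<close>

definition prefix_set :: "nat \<Rightarrow> nat set" where
  "prefix_set k = {m. \<exists>i. m div 2 ^ i = 2 ^ Suc k}"

text \<open>Deleting the last digit keeps the prefix unless the number is the bare prefix
  itself.\<close>

lemma prefix_set_step:
  assumes "m \<noteq> 2 ^ Suc k"
  shows "m \<in> prefix_set k \<longleftrightarrow> m div 2 \<in> prefix_set k"
proof -
  have "(\<exists>i. m div 2 ^ i = 2 ^ Suc k) \<longleftrightarrow> (\<exists>i. m div 2 ^ Suc i = 2 ^ Suc k)"
  proof
    assume "\<exists>i. m div 2 ^ i = 2 ^ Suc k"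
    then obtain i where "m div 2 ^ i = 2 ^ Suc k" by blast
    with assms show "\<exists>i. m div 2 ^ Suc i = 2 ^ Suc k" by (cases i) (simp, blast)
  qed blast
  then show ?thesis by (simp add: prefix_set_def div_mult2_eq)
qed

lemma prefix_set_ge: "m \<in> prefix_set k \<Longrightarrow> 2 ^ Suc k \<le> m"
proof -
  assume "m \<in> prefix_set k"
  then obtain i where "m div 2 ^ i = 2 ^ Suc k" by (auto simp: prefix_set_def)
  with div_le_dividend[of m "2 ^ i"] show ?thesis by linarith
qed

lemma power_2_in_prefix_set: "2 ^ (Suc k + i) \<in> prefix_set k"
proof -
  have "(2::nat) ^ (Suc k + i) div 2 ^ i = 2 ^ Suc k"
    unfolding power_add by simp
  then show ?thesis unfolding prefix_set_def by blast
qed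

text \<open>These numbers begin with 11 in binary, while the prefix has a zero in second place.
  Halving leads down to \<open>3\<close> and then to \<open>1\<close>, which is below
  \<open>2 ^ Suc k\<close>.\<close>

lemma three_times_power_2_notin_prefix_set: "3 * 2 ^ j \<notin> prefix_set k"
proof (induction j)
  case 0
  from prefix_set_step[OF three_times_power_2_neq_power_2[of 0]]
  have "3 \<in> prefix_set k \<longleftrightarrow> 1 \<in> prefix_set k" by simp
  moreover have "(1::nat) < 2 ^ Suc k" by (rule one_less_power) simp_all
  ultimately show ?case using prefix_set_ge[of 1 k] by auto
next
  case (Suc j)
  from prefix_set_step[OF three_times_power_2_neq_power_2[of "Suc j"]]
  have "3 * 2 ^ Suc j \<in> prefix_set k \<longleftrightarrow> 3 * 2 ^ j \<in> prefix_set k"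
    by simp
  with Suc show ?case by blast
qed

text \<open>Each element is the bare prefix or arises from a smaller one by appending a digit, so
  the count at most doubles plus one. The strict inequality absorbs that extra one.\<close>

lemma card_prefix_set_less: "card {m \<in> prefix_set k. m < 2 ^ (Suc k + i)} < 2 ^ i"
proof (induction i)
  case 0
  have "{m \<in> prefix_set k. m < 2 ^ Suc k} = {}" by (auto dest: prefix_set_ge)
  then show ?case by (simp del: power_Suc)
next
  case (Suc i)
  let ?G = "\<lambda>i. {m \<in> prefix_set k. m < 2 ^ (Suc k + i)}"
  have "?G (Suc i) \<subseteq> insert (2 ^ Suc k) ((*) 2 ` ?G i \<union> (\<lambda>m. Suc (2 * m)) ` ?G i)"
  proof
    fix m assume m: "m \<in> ?G (Suc i)"
    show "m \<in> insert (2 ^ Suc k) ((*) 2 ` ?G i \<union> (\<lambda>m. Suc (2 * m)) ` ?G i)"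
    proof (cases "m = 2 ^ Suc k")
      case False
      with m have "m div 2 \<in> ?G i" using prefix_set_step[of m k] by auto
      moreover have "m = 2 * (m div 2) \<or> m = Suc (2 * (m div 2))" by presburger
      ultimately show ?thesis by blast
    qed simp
  qed
  then have "card (?G (Suc i)) \<le> card (insert (2 ^ Suc k) ((*) 2 ` ?G i \<union> (\<lambda>m. Suc (2 * m)) ` ?G i))"
    by (intro card_mono) auto
  also have "\<dots> \<le> Suc (card ((*) 2 ` ?G i \<union> (\<lambda>m. Suc (2 * m)) ` ?G i))"
    by (rule card_insert_le_m1) simp_all
  also have "\<dots> \<le> Suc (card ((*) 2 ` ?G i) + card ((\<lambda>m. Suc (2 * m)) ` ?G i))"
    using card_Un_le by auto
  also have "\<dots> \<le> Suc (card (?G i) + card (?G i))"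
    by (intro Suc_le_mono[THEN iffD2] add_mono card_image_le) simp_all
  also have "\<dots> < 2 ^ Suc i" using Suc by simp
  finally show ?case .
qed

text \<open>Halving is injective on \<open>B0\<close> and lands in the set counted before, except
  that the bare prefix goes to \<open>2 ^ k\<close>. The strict bound leaves room for this one
  value.\<close>

lemma card_prefix_set_Int_B0_le: "card {m \<in> prefix_set k \<inter> B0. m < 2 ^ (Suc (Suc k) + i)} \<le> 2 ^ i"
proof -
  let ?C = "{m \<in> prefix_set k \<inter> B0. m < 2 ^ (Suc (Suc k) + i)}"
  let ?G = "{m \<in> prefix_set k. m < 2 ^ (Suc k + i)}"
  have "(\<lambda>m. m div 2) ` ?C \<subseteq> insert (2 ^ k) ?G"
  proof (rule image_subsetI)
    fix m assume m: "m \<in> ?C"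
    show "m div 2 \<in> insert (2 ^ k) ?G"
    proof (cases "m = 2 ^ Suc k")
      case False
      with m have "m div 2 \<in> prefix_set k" by (simp flip: prefix_set_step)
      moreover have "m div 2 < 2 ^ (Suc k + i)" using m by auto
      ultimately show ?thesis by simp
    qed simp
  qed
  then have "card ((\<lambda>m. m div 2) ` ?C) \<le> card (insert (2 ^ k) ?G)"
    by (intro card_mono) auto
  also have "\<dots> \<le> Suc (card ?G)" by (rule card_insert_le_m1) simp_all
  also have "\<dots> \<le> 2 ^ i" using card_prefix_set_less[of k i] by simp
  finally have "card ((\<lambda>m. m div 2) ` ?C) \<le> 2 ^ i" .
  moreover have "inj_on (\<lambda>m. m div 2) ?C"
    by (rule inj_on_subset[OF inj_on_div_2_B0]) blast
  ultimately show ?thesis by (simp only: card_image)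
qed

section \<open>The twisted Thue-Morse set and its representation counts\<close>

definition twisted_A0 :: "nat \<Rightarrow> nat set" where
  "twisted_A0 k = {a. (a \<in> A0) \<noteq> (a = 0 \<or> a \<in> prefix_set k)}"

text \<open>Appending a zero preserves the number of ones, and membership in
  \<open>prefix_set k\<close> changes only at the bare prefix, that is for
  \<open>j = 2 ^ k\<close>.\<close>

lemma double_in_twisted_A0_iff:
  assumes "j \<noteq> 0" "j \<noteq> 2 ^ k"
  shows "2 * j \<in> twisted_A0 k \<longleftrightarrow> j \<in> twisted_A0 k"
  using assms prefix_set_step[of "2 * j" k] by (simp add: twisted_A0_def double_in_A0_iff)

text \<open>Appending a one reverses the parity, and an odd number is never the bare prefix. At
  \<open>j = 0\<close> the rule fails, since \<open>0\<close> is flipped but \<open>1\<close> is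
  not.\<close>

lemma Suc_double_in_twisted_A0_iff:
  assumes "j \<noteq> 0"
  shows "Suc (2 * j) \<in> twisted_A0 k \<longleftrightarrow> j \<notin> twisted_A0 k"
proof -
  have "Suc (2 * j) \<noteq> 2 ^ Suc k" by (simp, presburger)
  from prefix_set_step[OF this] show ?thesis using assms
    by (auto simp: twisted_A0_def Suc_double_in_A0_iff)
qed

lemma sum_membership_sign_twisted_A0:
  assumes "2 ^ k < m"
  shows "(\<Sum>a<2 * m. membership_sign (twisted_A0 k) a) = 0"
proof -
  let ?s = "membership_sign (twisted_A0 k)"
  \<comment> \<open>At \<open>j = 0\<close> both signs are -1, because \<open>0\<close> is flipped
    out of the set. At \<open>j = 2 ^ k\<close> both are 1, because the bare prefix is flipped in.
    The assumption \<open>2 ^ k < m\<close> puts both exceptions in range.\<close>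
  have pair: "?s (2 * j) + ?s (Suc (2 * j)) = (if j = 0 then -2 else 0) + (if j = 2 ^ k then 2 else 0)" for j
  proof -
    consider "j = 0" | "j = 2 ^ k" | "j \<noteq> 0" "j \<noteq> 2 ^ k" by blast
    then show ?thesis
    proof cases
      case 1
      have "Suc 0 \<notin> prefix_set k" using prefix_set_ge[of "Suc 0" k] by (metis less_le_not_le one_less_numeral_iff one_less_power semiring_norm(76) zero_less_Suc One_nat_def)
      then show ?thesis using 1
        by (simp add: membership_sign_def twisted_A0_def zero_in_A0 one_notin_A0)
    next
      case 2
      have "2 ^ k \<notin> prefix_set k" using prefix_set_ge[of "2 ^ k" k] by auto
      then have "j \<notin> twisted_A0 k" using 2 by (simp add: twisted_A0_def power_2_notin_A0)
      moreover have "2 * j \<in> twisted_A0 k"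
        using 2 power_2_in_prefix_set[of k 0] by (simp add: twisted_A0_def double_in_A0_iff power_2_notin_A0)
      ultimately show ?thesis using 2
        by (simp add: membership_sign_def Suc_double_in_twisted_A0_iff)
    next
      case 3
      then show ?thesis
        by (simp add: membership_sign_def double_in_twisted_A0_iff Suc_double_in_twisted_A0_iff)
    qed
  qed
  show ?thesis using assms unfolding sum_lessThan_double pair
    by (simp add: sum.distrib)
qed

text \<open>For odd \<open>n\<close> the sum of signs consists of complete pairs and vanishes. For
  \<open>n = 2 * h\<close> only the last sign survives, and it equals the correction term at
  \<open>h\<close> because \<open>h > 2 ^ k\<close>.\<close>

lemma R2_twisted_A0_eq_complement:
  assumes "2 ^ k < m" "2 * m - 1 \<le> n"
  shows "R2 (twisted_A0 k) (int n) = R2 (- twisted_A0 k) (int n)"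
proof -
  let ?s = "membership_sign (twisted_A0 k)"
  define h where "h = n div 2"
  have "(\<Sum>a\<le>n. ?s a) = (if even n then ?s (n div 2) else 0)"
  proof (cases "even n")
    case True
    then have n: "n = 2 * h" by (simp add: h_def)
    then have h: "2 ^ k < h" using assms by auto
    have "(\<Sum>a\<le>n. ?s a) = (\<Sum>a<2 * h. ?s a) + ?s (2 * h)"
      by (simp add: n flip: lessThan_Suc_atMost)
    also have "?s (2 * h) = ?s h"
      using h by (simp add: membership_sign_def double_in_twisted_A0_iff)
    also have "(\<Sum>a<2 * h. ?s a) + ?s h = ?s h"
      using h by (simp add: sum_membership_sign_twisted_A0)
    finally show ?thesis using n by simp
  next
    case False
    then have n: "Suc n = 2 * Suc h" by (simp add: h_def)
    then have h: "2 ^ k < Suc h" using assms by auto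
    have "(\<Sum>a\<le>n. ?s a) = (\<Sum>a<2 * Suc h. ?s a)"
      by (simp only: n flip: lessThan_Suc_atMost)
    also have "\<dots> = 0" by (rule sum_membership_sign_twisted_A0[OF h])
    finally show ?thesis using False by simp
  qed
  then show ?thesis using R2_diff_complement[of "twisted_A0 k" n] by simp
qed

lemma R2_twisted_A0_le:
  assumes "odd (Suc (Suc k) + i)"
  shows "R2 (twisted_A0 k) (int (2 ^ (Suc (Suc k) + i) - 1)) \<le> 2 ^ i"
proof -
  define L where "L = Suc (Suc k) + i"
  let ?n = "2 ^ L - 1 :: nat"
  let ?C = "{m \<in> prefix_set k \<inter> B0. m < 2 ^ L}"
  let ?A = "twisted_A0 k"
  \<comment> \<open>The element of \<open>?C\<close> may be either term of the solution; since
    \<open>2 * a < ?n\<close>, the minimum recovers \<open>a\<close> in both cases.\<close>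
  have "{a. 2 * a < ?n \<and> a \<in> ?A \<and> ?n - a \<in> ?A} \<subseteq> (\<lambda>m. min m (?n - m)) ` ?C"
  proof
    fix a assume "a \<in> {a. 2 * a < ?n \<and> a \<in> ?A \<and> ?n - a \<in> ?A}"
    then have a: "2 * a < ?n" "a \<in> ?A" "?n - a \<in> ?A" by auto
    have compl: "?n - a \<in> A0 \<longleftrightarrow> a \<notin> A0"
      using complement_in_A0_iff[of a L] assms a(1) by (auto simp: L_def)
    show "a \<in> (\<lambda>m. min m (?n - m)) ` ?C"
    proof (cases "a \<in> A0")
      case True
      then have "?n - a \<in> ?C" "a = min (?n - a) (?n - (?n - a))"
        using a compl by (auto simp: twisted_A0_def B0_def)
      then show ?thesis by blast
    next
      case False
      then have "a \<in> ?C" "a = min a (?n - a)"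
        using a zero_in_A0 by (auto simp: twisted_A0_def B0_def)
      then show ?thesis by blast
    qed
  qed
  then have "R2 ?A (int ?n) \<le> card ((\<lambda>m. min m (?n - m)) ` ?C)"
    unfolding R2_eq_card by (intro card_mono) auto
  also have "\<dots> \<le> card ?C" by (intro card_image_le) simp
  also have "\<dots> \<le> 2 ^ i" unfolding L_def by (rule card_prefix_set_Int_B0_le)
  finally show ?thesis by (simp add: L_def)
qed

section \<open>Infinite intersections and conclusion\<close>

lemma infinite_twisted_A0_Int_A0: "infinite (twisted_A0 k \<inter> A0)"
proof (rule infinite_super)
  show "range (\<lambda>j. 3 * 2 ^ j) \<subseteq> twisted_A0 k \<inter> A0"
    by (auto simp: twisted_A0_def three_times_power_2_in_A0 three_times_power_2_notin_prefix_set)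
  show "infinite (range (\<lambda>j. 3 * 2 ^ j :: nat))"
    by (simp add: finite_image_iff inj_def)
qed

text \<open>Powers of two from \<open>2 ^ Suc k\<close> on have a single one and begin with the
  prefix, so they are elements of \<open>B0\<close> that the symmetric difference adds.\<close>

lemma infinite_twisted_A0_Int_B0: "infinite (twisted_A0 k \<inter> B0)"
proof -
  define f where "f i = (2::nat) ^ (Suc k + i)" for i
  have "f i \<in> prefix_set k" "f i \<notin> A0" for i
    unfolding f_def by (rule power_2_in_prefix_set power_2_notin_A0)+
  then have "range f \<subseteq> twisted_A0 k \<inter> B0"
    by (auto simp: twisted_A0_def B0_def)
  moreover have "inj f"
    by (rule injI) (simp add: f_def)
  then have "infinite (range f)" by (simp add: finite_image_iff)
  ultimately show ?thesis by (rule infinite_super)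
qed

theorem theorem1:
  fixes N :: int
  assumes "N \<ge> 2"
  shows "\<exists>A :: nat set.
           (\<forall>n :: int. n \<ge> 2 * N - 1 \<longrightarrow> R2 A n = R2 (- A) n) \<and>
           infinite (A \<inter> A0) \<and>
           infinite (A \<inter> B0) \<and>
           infinite {n :: int. real (R2 A n) \<le>
             (real_of_int n + 1) / (4 * 2 powi \<lfloor>log 2 (real_of_int (N - 1))\<rfloor>)}"
proof -
  define k where "k = nat \<lfloor>log 2 (real_of_int (N - 1))\<rfloor>"
  \<comment> \<open>Since \<open>N - 1 \<ge> 1\<close>, the logarithm is nonnegative and
    \<open>nat\<close> loses nothing.\<close>
  have k: "\<lfloor>log 2 (real_of_int (N - 1))\<rfloor> = int k"
    using assms by (simp add: k_def)
  have "2 powr real k \<le> real_of_int (N - 1)"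
    using k assms by (subst le_log_iff[symmetric]) linarith+
  then have "real_of_int (2 ^ k) \<le> real_of_int (N - 1)" by (simp add: powr_realpow)
  then have "2 ^ k \<le> N - 1" by (simp only: of_int_le_iff)
  then have "int (2 ^ k) < int (nat N)" using assms by simp
  then have kN: "2 ^ k < nat N" by (simp only: of_nat_less_iff)
  have eq: "R2 (twisted_A0 k) n = R2 (- twisted_A0 k) n" if "n \<ge> 2 * N - 1" for n
    using R2_twisted_A0_eq_complement[OF kN, of "nat n"] that assms by simp
  let ?S = "{n :: int. real (R2 (twisted_A0 k) n) \<le> (real_of_int n + 1) / (4 * 2 ^ k)}"
  \<comment> \<open>The exponent equals \<open>2 * (j + k) + 3\<close>, hence is odd for every
    \<open>k\<close>, as the bound on \<open>R2\<close> requires.\<close>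
  define g where "g j = int (2 ^ (Suc (Suc k) + (2 * j + k + 1)) - 1)" for j
  have "range g \<subseteq> ?S"
  proof (rule image_subsetI, rule CollectI)
    fix j
    define i where "i = 2 * j + k + 1"
    have "R2 (twisted_A0 k) (g j) \<le> 2 ^ i"
      unfolding g_def i_def by (rule R2_twisted_A0_le) simp
    then have "real (R2 (twisted_A0 k) (g j)) \<le> 2 ^ i"
      by (metis of_nat_le_iff of_nat_numeral of_nat_power)
    also have "\<dots> = (real_of_int (g j) + 1) / (4 * 2 ^ k)"
    proof -
      \<comment> \<open>Dividing this power by \<open>4 * 2 ^ k = 2 ^ Suc (Suc k)\<close> leaves
        exactly \<open>2 ^ i\<close>.\<close>
      have "real_of_int (g j) + 1 = 2 ^ (Suc (Suc k) + i)"
        by (simp add: g_def i_def of_nat_diff)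
      then show ?thesis by (simp add: power_add)
    qed
    finally show "real (R2 (twisted_A0 k) (g j)) \<le> (real_of_int (g j) + 1) / (4 * 2 ^ k)" .
  qed
  moreover have "inj g"
    by (rule injI) (simp add: g_def of_nat_diff)
  then have "infinite (range g)" by (simp add: finite_image_iff)
  ultimately have "infinite ?S" by (rule infinite_super)
  then show ?thesis
    using eq infinite_twisted_A0_Int_A0 infinite_twisted_A0_Int_B0
    by (intro exI[of _ "twisted_A0 k"]) (simp only: k power_int_of_nat, simp)
qed

end
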